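(* For every $n\ge 1$, let $G_n^8$ be the graph on vertex set $\{a,b,c,d\}\cup\{1,2,\dots,n\}\cup\{x\}$ with the following edges: among $\{a,b,c,d\}$ exactly the edges $\{a,c\},\{a,d\},\{b,c\},\{b,d\}$; among $\{1,\dots,n\}$ every pair $\{i,j\}$ with $|i-j|\ge 2$ (so the only non-edges there are $\{i,i+1\}$, $1\le i\le n-1$); the edges $\{x,i\}$ for all $1\le i\le n$, and $\{x,a\}$, $\{x,d\}$; the edges $\{a,i\}$ for all $2\le i\le n$; and the edges $\{d,i\}$ for all $1\le i\le n-1$. There are no other edges. Then $G_n^8$ is word-representable.
   Context: All graphs are finite and simple. For a word $w$ and letters $i,j$, let $w_{ij}$ be the subsequence of $w$ consisting of all occurrences of $i$ and $j$; $i$ and $j$ alternate in $w$ if $w_{ij}$ contains no factor $ii$ or $jj$. A graph $G$ is word-representable if there is a word $w$ over $V(G)$ such that for all distinct $i,j\in V(G)$, $\{i,j\}\in E(G)$ if and only if $i$ and $j$ alternate in $w$. *)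

theory Defs
  imports Main "HOL-Library.Sublist"
begin

definition simple_graph :: "'a set \<Rightarrow> 'a set set \<Rightarrow> bool" where
  "simple_graph V E \<longleftrightarrow> finite V \<and> (\<forall>e\<in>E. e \<subseteq> V \<and> card e = 2)"

definition restrict_word :: "'a list \<Rightarrow> 'a \<Rightarrow> 'a \<Rightarrow> 'a list" where
  "restrict_word w i j = filter (\<lambda>k. k = i \<or> k = j) w"

(* A factor is a contiguous subword, which is what sublist means. *)
definition alternate :: "'a list \<Rightarrow> 'a \<Rightarrow> 'a \<Rightarrow> bool" where
  "alternate w i j \<longleftrightarrow>
     \<not> sublist [i, i] (restrict_word w i j) \<and> \<not> sublist [j, j] (restrict_word w i j)"

(* A word over V need not use every letter of V. Requiring every letter to occur
   gives the same notion; see word_representable_iff_all_letters below. *)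
definition word_representable :: "'a set \<Rightarrow> 'a set set \<Rightarrow> bool" where
  "word_representable V E \<longleftrightarrow>
     (\<exists>w \<in> lists V. \<forall>i\<in>V. \<forall>j\<in>V. i \<noteq> j \<longrightarrow> ({i, j} \<in> E \<longleftrightarrow> alternate w i j))"

lemma alternate_commute: "alternate w i j \<longleftrightarrow> alternate w j i"
proof -
  have "restrict_word w i j = restrict_word w j i"
    unfolding restrict_word_def by (rule filter_cong) auto
  then show ?thesis unfolding alternate_def by auto
qed

lemma alternate_Cons_absent:
  assumes "m \<notin> set w" and "m \<noteq> j"
  shows "alternate (m # w) m j \<longleftrightarrow> alternate w m j"
proof -
  have "m \<notin> set (restrict_word w m j)"
    using assms by (simp add: restrict_word_def)
  then show ?thesis
    using assms(2)
    by (auto simp: alternate_def restrict_word_def sublist_Cons_right prefix_Cons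
             dest: set_mono_sublist set_mono_prefix)
qed

lemma alternate_Cons_other:
  assumes "m \<noteq> i" and "m \<noteq> j"
  shows "alternate (m # w) i j \<longleftrightarrow> alternate w i j"
  using assms by (simp add: alternate_def restrict_word_def)

lemma alternate_append_absent:
  assumes "distinct ms" and "set ms \<inter> set w = {}" and "i \<noteq> j"
  shows "alternate (ms @ w) i j \<longleftrightarrow> alternate w i j"
  using assms
proof (induction ms)
  case (Cons m ms)
  then have "m \<notin> set (ms @ w)" by auto
  then have "alternate (m # ms @ w) i j \<longleftrightarrow> alternate (ms @ w) i j"
    using Cons.prems(3) alternate_Cons_absent alternate_Cons_other alternate_commute
    by metis
  with Cons show ?case by simp
qed simp

lemma word_representable_iff_all_letters:
  assumes "finite V"
  shows "word_representable V E \<longleftrightarrow>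
    (\<exists>w. set w = V \<and> (\<forall>i\<in>V. \<forall>j\<in>V. i \<noteq> j \<longrightarrow> ({i, j} \<in> E \<longleftrightarrow> alternate w i j)))"
    (is "_ \<longleftrightarrow> ?R")
proof
  assume "word_representable V E"
  then obtain w where w: "set w \<subseteq> V"
      "\<forall>i\<in>V. \<forall>j\<in>V. i \<noteq> j \<longrightarrow> ({i, j} \<in> E \<longleftrightarrow> alternate w i j)"
    by (auto simp: word_representable_def)
  obtain ms where ms: "set ms = V - set w" "distinct ms"
    using assms finite_distinct_list[of "V - set w"] by auto
  have "alternate (ms @ w) i j \<longleftrightarrow> alternate w i j" if "i \<noteq> j" for i j
    using alternate_append_absent[OF ms(2) _ that] ms(1) by blast
  moreover have "set (ms @ w) = V" using ms w by auto
  ultimately show ?R using w by (intro exI[of _ "ms @ w"]) auto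
next
  assume ?R
  then show "word_representable V E" by (auto simp: word_representable_def)
qed

datatype vertex = A | B | C | D | Num nat | X

definition G8_verts :: "nat \<Rightarrow> vertex set" where
  "G8_verts n = {A, B, C, D} \<union> Num ` {1..n} \<union> {X}"

definition G8_edges :: "nat \<Rightarrow> vertex set set" where
  "G8_edges n =
     {{A, C}, {A, D}, {B, C}, {B, D}}
     \<union> {{Num i, Num j} | i j. i \<in> {1..n} \<and> j \<in> {1..n} \<and> \<bar>int i - int j\<bar> \<ge> 2}
     \<union> {{X, Num i} | i. i \<in> {1..n}} \<union> {{X, A}, {X, D}}
     \<union> {{A, Num i} | i. i \<in> {2..n}}
     \<union> {{D, Num i} | i. 1 \<le> i \<and> i \<le> n - 1}"

lemma simple_graph_G8: "simple_graph (G8_verts n) (G8_edges n)"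
  by (auto simp: simple_graph_def G8_verts_def G8_edges_def card_insert_if)

end

theory Submission
  imports Defs
begin

text \<open>
  Put \<open>v\<^sub>0 = A\<close>, \<open>v\<^sub>i = Num i\<close> for \<open>1 \<le> i \<le> n\<close> and \<open>v\<^sub>m = D\<close> with \<open>m = n + 1\<close>. On these vertices the
  graph is the complement of the path \<open>v\<^sub>0, \<dots>, v\<^sub>m\<close>, so concatenated permutations represent it as
  soon as each of them only ever swaps neighbours of the path and each neighbouring pair occurs in
  both orders. The permutations \<open>v\<^sub>1 v\<^sub>0 v\<^sub>3 v\<^sub>2 \<dots>\<close>, \<open>v\<^sub>0 v\<^sub>2 v\<^sub>1 v\<^sub>4 v\<^sub>3 \<dots>\<close> and \<open>v\<^sub>0 v\<^sub>1 \<dots> v\<^sub>m\<close> do this. The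
  second one begins with \<open>A\<close> and the third one ends with \<open>D\<close>, which leaves room to insert the
  remaining letters:
  \[ v_1 v_0 v_3 v_2 \cdots\; C\, B\, X\; A\, C\; v_2 v_1 v_4 v_3 \cdots\; X\; v_0 v_1 \cdots v_n\; B\, D\, X\, C. \]
  Here \<open>X\<close> separates the permutations, between the two occurrences of \<open>B\<close> every vertex except
  \<open>C\<close> and \<open>D\<close> occurs twice, and \<open>C C\<close> is a factor of the restriction to \<open>C\<close> and any vertex other
  than \<open>A\<close>, \<open>B\<close>, \<open>X\<close>. Finally, \<open>C\<close> and \<open>X\<close> do not alternate because no \<open>C\<close> lies between the last two
  occurrences of \<open>X\<close>.
\<close>

lemma distinct_adj_iff_no_square: "distinct_adj xs \<longleftrightarrow> (\<forall>x. \<not> sublist [x, x] xs)"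
proof (induction xs)
  case (Cons y ys)
  then show ?case
    by (cases ys) (auto simp: sublist_Cons_right)
qed simp

text \<open>The restriction has no letters besides \<open>i\<close> and \<open>j\<close>, so any
  square in it is one of the two forbidden factors. On explicit lists \<open>distinct_adj\<close>
  simply evaluates.\<close>

lemma alternate_iff_distinct_adj: "alternate w i j \<longleftrightarrow> distinct_adj (restrict_word w i j)"
proof -
  have "x = i \<or> x = j" if "sublist [x, x] (restrict_word w i j)" for x
    using set_mono_sublist[OF that] by (auto simp: restrict_word_def)
  then show ?thesis
    by (auto simp: alternate_def distinct_adj_iff_no_square)
qed

fun swap_pairs :: "'a list \<Rightarrow> 'a list" where
  "swap_pairs (x # y # zs) = y # x # swap_pairs zs"
| "swap_pairs zs = zs"

lemma set_swap_pairs [simp]: "set (swap_pairs xs) = set xs"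
  by (induction xs rule: swap_pairs.induct) auto

lemma distinct_swap_pairs [simp]: "distinct (swap_pairs xs) \<longleftrightarrow> distinct xs"
  by (induction xs rule: swap_pairs.induct) auto

lemma filter_eq_single: "distinct xs \<Longrightarrow> i \<in> set xs \<Longrightarrow> filter (\<lambda>k. k = i) xs = [i]"
  by (induction xs) (auto simp: filter_empty_conv)

lemma filter_pair_upt:
  assumes "s \<le> i" "i < j" "j < t"
  shows "filter (\<lambda>k. k = i \<or> k = j) [s..<t] = [i, j]"
  using assms by (intro sorted_distinct_set_unique) (auto simp: sorted_wrt_filter)

text \<open>Induction strips the first swapped pair \<open>s, Suc s\<close>; this shifts
  \<open>s\<close> by two and so keeps the parity of \<open>i - s\<close>.\<close>

lemma filter_pair_swap_pairs_upt:
  assumes "s \<le> i" "i < j" "j < t"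
  shows "filter (\<lambda>k. k = i \<or> k = j) (swap_pairs [s..<t]) =
    (if j = Suc i \<and> even (i - s) then [j, i] else [i, j])"
  using assms
proof (induction "t - s" arbitrary: s rule: less_induct)
  case less
  have eq: "swap_pairs [s..<t] = Suc s # s # swap_pairs [Suc (Suc s)..<t]"
    using less.prems by (simp add: upt_conv_Cons)
  have single: "filter (\<lambda>k. k = j) (swap_pairs [Suc (Suc s)..<t]) = [j]" if "Suc (Suc s) \<le> j"
    using that less.prems by (intro filter_eq_single) auto
  have none: "filter (\<lambda>k. k = s \<or> k = Suc s) (swap_pairs [Suc (Suc s)..<t]) = []"
    by (auto simp: filter_empty_conv)
  consider "i = s" "j = Suc s" | "i = s" "Suc (Suc s) \<le> j" | "i = Suc s" | "Suc (Suc s) \<le> i"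
    using less.prems by linarith
  then show ?case
  proof cases
    case 1
    then show ?thesis using none by (simp add: eq)
  next
    case 2
    then have "filter (\<lambda>k. k = i \<or> k = j) (swap_pairs [Suc (Suc s)..<t]) =
      filter (\<lambda>k. k = j) (swap_pairs [Suc (Suc s)..<t])"
      by (intro filter_cong) auto
    with 2 single show ?thesis by (simp add: eq)
  next
    case 3
    then have "filter (\<lambda>k. k = i \<or> k = j) (swap_pairs [Suc (Suc s)..<t]) =
      filter (\<lambda>k. k = j) (swap_pairs [Suc (Suc s)..<t])"
      by (intro filter_cong) auto
    with 3 single less.prems show ?thesis by (simp add: eq)
  next
    case 4
    then have "even (i - s) \<longleftrightarrow> even (i - Suc (Suc s))"
      by presburger
    with 4 less.hyps[of "Suc (Suc s)"] less.prems show ?thesis by (simp add: eq)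
  qed
qed

definition copath_vertex :: "nat \<Rightarrow> nat \<Rightarrow> vertex" where
  "copath_vertex n i = (if i = 0 then A else if i = Suc n then D else Num i)"

lemma copath_vertex_eq_iff [simp]: "copath_vertex n i = copath_vertex n j \<longleftrightarrow> i = j"
  by (auto simp: copath_vertex_def)

lemma copath_vertex_neq [simp]:
  "copath_vertex n i \<noteq> B" "copath_vertex n i \<noteq> C" "copath_vertex n i \<noteq> X"
  "B \<noteq> copath_vertex n i" "C \<noteq> copath_vertex n i" "X \<noteq> copath_vertex n i"
  by (auto simp: copath_vertex_def)

lemma G8_verts_eq: "G8_verts n = {B, C, X} \<union> copath_vertex n ` {..Suc n}"
proof -
  have "{..Suc n} = {0, Suc n} \<union> {1..n}" by auto
  moreover have "copath_vertex n ` {0, Suc n} = {A, D}"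
    by (auto simp: copath_vertex_def)
  moreover have "copath_vertex n ` {1..n} = Num ` {1..n}"
    by (intro image_cong) (auto simp: copath_vertex_def)
  ultimately have "copath_vertex n ` {..Suc n} = {A, D} \<union> Num ` {1..n}"
    by (simp only: image_Un)
  then show ?thesis by (auto simp: G8_verts_def)
qed

lemma G8_edge_copath_iff:
  assumes "n \<ge> 1" "i < j" "j \<le> Suc n"
  shows "{copath_vertex n i, copath_vertex n j} \<in> G8_edges n \<longleftrightarrow> j \<noteq> Suc i"
proof (cases "0 < i \<and> j \<le> n")
  case True
  then have "{copath_vertex n i, copath_vertex n j} \<in> G8_edges n \<longleftrightarrow> \<bar>int i - int j\<bar> \<ge> 2"
    using assms by (auto simp: copath_vertex_def G8_edges_def doubleton_eq_iff)
      (rule exI[of _ i], rule exI[of _ j], simp)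
  with assms show ?thesis by auto
next
  case False
  then show ?thesis
    using assms by (auto simp: copath_vertex_def G8_edges_def doubleton_eq_iff)
qed

lemma G8_edge_X_copath: "i \<le> Suc n \<Longrightarrow> {X, copath_vertex n i} \<in> G8_edges n"
  by (auto simp: copath_vertex_def G8_edges_def doubleton_eq_iff)

lemma G8_edge_B_copath_iff: "{B, copath_vertex n i} \<in> G8_edges n \<longleftrightarrow> i = Suc n"
  by (auto simp: copath_vertex_def G8_edges_def doubleton_eq_iff)

lemma G8_edge_C_copath_iff: "{C, copath_vertex n i} \<in> G8_edges n \<longleftrightarrow> i = 0"
  by (auto simp: copath_vertex_def G8_edges_def doubleton_eq_iff)

lemma G8_edges_BCX:
  "{B, C} \<in> G8_edges n" "{B, X} \<notin> G8_edges n" "{C, X} \<notin> G8_edges n"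
  by (auto simp: G8_edges_def doubleton_eq_iff)

definition G8_word :: "nat \<Rightarrow> vertex list" where
  "G8_word n =
     map (copath_vertex n) (swap_pairs [0..<n + 2]) @
     [C, B, X, copath_vertex n 0, C] @
     map (copath_vertex n) (swap_pairs [1..<n + 2]) @
     [X] @
     map (copath_vertex n) [0..<Suc n] @
     [B, copath_vertex n (Suc n), X, C]"

lemma set_G8_word: "set (G8_word n) \<subseteq> G8_verts n"
  by (auto simp: G8_word_def G8_verts_eq)

lemma alternate_G8_word_copath_iff:
  assumes "i < j" "j \<le> Suc n"
  shows "alternate (G8_word n) (copath_vertex n i) (copath_vertex n j) \<longleftrightarrow> j \<noteq> Suc i"
proof -
  let ?P = "\<lambda>k. k = i \<or> k = j"
  have 1: "filter ?P (swap_pairs [0..<n + 2]) = (if j = Suc i \<and> even i then [j, i] else [i, j])"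
    using filter_pair_swap_pairs_upt[of 0 i j "n + 2"] assms by simp
  have 2: "filter ?P (0 # swap_pairs [1..<n + 2]) =
      (if j = Suc i \<and> odd i then [j, i] else [i, j])"
  \<comment> \<open>Swapping starts at 1 here, so the fixed leading 0 is out of reach of
    \<open>filter_pair_swap_pairs_upt\<close>.\<close>
  proof (cases "i = 0")
    case True
    have "filter ?P (swap_pairs [1..<n + 2]) = filter (\<lambda>k. k = j) (swap_pairs [1..<n + 2])"
      using True by (intro filter_cong) auto
    also have "\<dots> = [j]"
      using assms by (intro filter_eq_single) auto
    finally show ?thesis using True by simp
  next
    case False
    with filter_pair_swap_pairs_upt[of 1 i j "n + 2"] assms show ?thesis by auto
  qed
  have 3: "filter ?P ([0..<Suc n] @ [Suc n]) = [i, j]"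
    using filter_pair_upt[of 0 i j "Suc (Suc n)"] assms by simp
  have "restrict_word (G8_word n) (copath_vertex n i) (copath_vertex n j) =
      map (copath_vertex n) (filter ?P (swap_pairs [0..<n + 2]) @
        filter ?P (0 # swap_pairs [1..<n + 2]) @ filter ?P ([0..<Suc n] @ [Suc n]))"
    by (simp add: restrict_word_def G8_word_def filter_map comp_def del: upt_Suc)
  \<comment> \<open>If \<open>j = Suc i\<close>, the first two blocks order the pair oppositely, so
    equal letters meet at their border; otherwise all three blocks are
    \<open>[i, j]\<close>.\<close>
  then show ?thesis
    using assms unfolding 1 2 3 alternate_iff_distinct_adj by auto
qed

lemma filter_copath:
  assumes "u \<in> {B, C, X}" "distinct ks"
  shows "filter (\<lambda>k. k = u \<or> k = copath_vertex n i) (map (copath_vertex n) ks) =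
    (if i \<in> set ks then [copath_vertex n i] else [])"
  using assms filter_eq_single[of ks i] by (auto simp: filter_map comp_def filter_empty_conv)

text \<open>Each path vertex occurs three times. Relative to the inserted letters only two are
  placed differently: 0, before the second \<open>C\<close>, and \<open>Suc n\<close>, after the
  second \<open>B\<close>.\<close>

lemma restrict_G8_word_copath:
  assumes "i \<le> Suc n" "u \<in> {B, C, X}"
  shows "restrict_word (G8_word n) u (copath_vertex n i) = copath_vertex n i #
    filter (\<lambda>k. k = u) [C, B, X] @
    (if i = 0 then copath_vertex n i # filter (\<lambda>k. k = u) [C]
     else filter (\<lambda>k. k = u) [C] @ [copath_vertex n i]) @
    filter (\<lambda>k. k = u) [X] @
    (if i = Suc n then filter (\<lambda>k. k = u) [B] @ [copath_vertex n i]
     else copath_vertex n i # filter (\<lambda>k. k = u) [B]) @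
    filter (\<lambda>k. k = u) [X, C]"
  using assms
  by (auto simp: restrict_word_def G8_word_def filter_copath simp del: upt_Suc)

lemma alternate_G8_word_X_copath:
  assumes "i \<le> Suc n"
  shows "alternate (G8_word n) X (copath_vertex n i)"
  using assms by (simp add: alternate_iff_distinct_adj restrict_G8_word_copath)

lemma alternate_G8_word_B_copath_iff:
  assumes "i \<le> Suc n"
  shows "alternate (G8_word n) B (copath_vertex n i) \<longleftrightarrow> i = Suc n"
  using assms by (simp add: alternate_iff_distinct_adj restrict_G8_word_copath)

lemma alternate_G8_word_C_copath_iff:
  assumes "i \<le> Suc n"
  shows "alternate (G8_word n) C (copath_vertex n i) \<longleftrightarrow> i = 0"
  using assms by (simp add: alternate_iff_distinct_adj restrict_G8_word_copath)

text \<open>The three restrictions are \<open>CBCBC\<close>, \<open>BXXBX\<close> and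
  \<open>CXCXXC\<close>.\<close>

lemma alternate_G8_word_BCX:
  "alternate (G8_word n) B C" "\<not> alternate (G8_word n) B X" "\<not> alternate (G8_word n) C X"
  by (simp_all add: alternate_iff_distinct_adj restrict_word_def G8_word_def filter_map comp_def
      del: upt_Suc)

theorem theorem8:
  fixes n :: nat
  assumes "n \<ge> 1"
  shows "word_representable (G8_verts n) (G8_edges n)"
proof -
  \<comment> \<open>Naming the condition exposes its symmetry, so one order of each pair
    suffices.\<close>
  define ok where "ok u v \<longleftrightarrow> ({u, v} \<in> G8_edges n \<longleftrightarrow> alternate (G8_word n) u v)" for u v
  have ok_sym: "ok u v \<longleftrightarrow> ok v u" for u v
    by (simp add: ok_def insert_commute alternate_commute)
  have copath_less: "ok (copath_vertex n i) (copath_vertex n j)" if "i < j" "j \<le> Suc n" for i j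
    using that assms by (simp add: ok_def G8_edge_copath_iff alternate_G8_word_copath_iff)
  have copath: "ok (copath_vertex n i) (copath_vertex n j)"
    if "i \<le> Suc n" "j \<le> Suc n" "i \<noteq> j" for i j
    using that copath_less ok_sym by (metis linorder_neqE_nat)
  have mixed: "ok u (copath_vertex n i)" if "i \<le> Suc n" "u \<in> {B, C, X}" for u i
    using that by (auto simp: ok_def G8_edge_X_copath G8_edge_B_copath_iff G8_edge_C_copath_iff
        alternate_G8_word_X_copath alternate_G8_word_B_copath_iff alternate_G8_word_C_copath_iff)
  have BCX: "ok B C" "ok B X" "ok C X"
    by (simp_all add: ok_def G8_edges_BCX alternate_G8_word_BCX)
  have "ok u v" if "u \<in> G8_verts n" "v \<in> G8_verts n" "u \<noteq> v" for u v
    using that copath mixed BCX ok_sym unfolding G8_verts_eq by (auto; metis)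
  then show ?thesis
    using set_G8_word[of n] unfolding word_representable_def ok_def by (metis in_listsI subsetD)
qed

end
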